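(* Let $b,\sigma^1,\ldots,\sigma^m:\mathbb{R}^d\to\mathbb{R}^d$ have continuous first-order partial derivatives, with $b(0)=0$, and suppose there is a constant $K\ge 0$ such that $\|\sigma^k(x)\|\le K\|x\|$ for all $x\in\mathbb{R}^d$ and $k=1,\ldots,m$. Assume that $$-\lambda:=\sup_{x\neq 0}\left(\frac{\langle x,b(x)\rangle+\frac12\sum_{k=1}^m\|\sigma^k(x)\|^2}{\|x\|^2}-\frac{\sum_{k=1}^m\langle x,\sigma^k(x)\rangle^2}{\|x\|^4}\right)<0 .$$ Let $\Delta>0$ be arbitrary and let $\bar X_n=\bar\eta_n\hat Z_n$, $n\ge 0$, be the sequence generated by the direction and norm decomposition scheme (defined in the context) with step-size $\Delta$, where $\bar\eta_0>0$. Then $$\limsup_{n\to\infty}\frac{1}{n\Delta}\log\left(\|\bar X_n\|\right)\le-\lambda\qquad\text{a.s.}$$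
   Context: $\|\cdot\|$ and $\langle\cdot,\cdot\rangle$ are the Euclidean norm and scalar product on $\mathbb{R}^d$; $Jg$ is the Jacobian matrix of $g$. Direction and norm decomposition scheme (for $b(0)=\sigma^1(0)=\cdots=\sigma^m(0)=0$). For $\eta\in\mathbb{R}$, $z\in\mathbb{R}^d$ put $\bar b(\eta,z)=b(\eta z)/\eta$ if $\eta\ne0$, $\bar b(0,z)=Jb(0)z$; $\bar\sigma^k(\eta,z)=\sigma^k(\eta z)/\eta$ if $\eta\neq 0$, $\bar\sigma^k(0,z)=J\sigma^k(0)z$; and $$\Psi(\eta,z)=\sum_{k=1}^m\left(\left(\tfrac32\langle z,\bar\sigma^k(\eta,z)\rangle^2-\tfrac12\|\bar\sigma^k(\eta,z)\|^2\right)z-\langle z,\bar\sigma^k(\eta,z)\rangle\bar\sigma^k(\eta,z)\right).$$ Let $\bar\eta_0\in\mathbb{R}$ and $\hat Z_0\in\mathbb{R}^d$ be random variables with $\bar\eta_0\ge0$ and $\|\hat Z_0\|=1$. Let $\hat W^1_1,\ldots,\hat W^m_1,\hat W^1_2,\ldots$ be i.i.d. real random variables with symmetric law and variance $1$, independent of $(\bar\eta_0,\hat Z_0)$. For $\Delta>0$ define recursively $$\bar\eta_{n+1}=\bar\eta_n\exp\left(\mu_n\Delta+\sum_{k=1}^m\langle\hat Z_n,\bar\sigma^k(\bar\eta_n,\hat Z_n)\rangle\sqrt\Delta\,\hat W^k_{n+1}\right),$$ $$\mu_n=\langle\hat Z_n,\bar b(\bar\eta_n,\hat Z_n)\rangle+\tfrac12\sum_{k=1}^m\|\bar\sigma^k(\bar\eta_n,\hat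 Z_n)\|^2-\sum_{k=1}^m\langle\hat Z_n,\bar\sigma^k(\bar\eta_n,\hat Z_n)\rangle^2,$$ $$\bar Z_{n+1}=\hat Z_n+\left(\bar b(\bar\eta_n,\hat Z_n)-\langle\hat Z_n,\bar b(\bar\eta_n,\hat Z_n)\rangle\hat Z_n+\Psi(\bar\eta_n,\hat Z_n)\right)\Delta+\sum_{k=1}^m\left(\bar\sigma^k(\bar\eta_n,\hat Z_n)-\langle\hat Z_n,\bar\sigma^k(\bar\eta_n,\hat Z_n)\rangle\hat Z_n\right)\sqrt\Delta\,\hat W^k_{n+1},$$ and $\hat Z_{n+1}=\bar Z_{n+1}/\|\bar Z_{n+1}\|$ if $\bar Z_{n+1}\ne0$, $\hat Z_{n+1}=\hat Z_n$ if $\bar Z_{n+1}=0$. Finally $\bar X_n:=\bar\eta_n\hat Z_n$. *)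

theory Defs
  imports "HOL-Probability.Probability"
begin

definition has_continuous_partials :: "(real ^ 'd \<Rightarrow> real ^ 'd) \<Rightarrow> bool" where
  "has_continuous_partials f \<longleftrightarrow>
     (\<forall>j. \<exists>D. continuous_on UNIV D \<and>
        (\<forall>x. ((\<lambda>t. f (x + t *\<^sub>R axis j 1)) has_vector_derivative D x) (at 0)))"

text \<open>The rescaled coefficient: \<open>rescale b\<close> is $\bar b$ and \<open>rescale (\<sigma> k)\<close> is $\bar\sigma^k$.\<close>

definition rescale :: "(real ^ 'd \<Rightarrow> real ^ 'd) \<Rightarrow> real \<Rightarrow> real ^ 'd \<Rightarrow> real ^ 'd" where
  "rescale f \<eta> z = (if \<eta> \<noteq> 0 then (1 / \<eta>) *\<^sub>R f (\<eta> *\<^sub>R z) else jacobian f (at 0) *v z)"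

definition Psi :: "nat \<Rightarrow> (nat \<Rightarrow> real ^ 'd \<Rightarrow> real ^ 'd) \<Rightarrow> real \<Rightarrow> real ^ 'd \<Rightarrow> real ^ 'd" where
  "Psi m \<sigma> \<eta> z =
     (\<Sum>k = 1..m. (3 / 2 * (z \<bullet> rescale (\<sigma> k) \<eta> z)\<^sup>2 - 1 / 2 * (norm (rescale (\<sigma> k) \<eta> z))\<^sup>2) *\<^sub>R z
                  - (z \<bullet> rescale (\<sigma> k) \<eta> z) *\<^sub>R rescale (\<sigma> k) \<eta> z)"

definition norm_drift ::
  "nat \<Rightarrow> (real ^ 'd \<Rightarrow> real ^ 'd) \<Rightarrow> (nat \<Rightarrow> real ^ 'd \<Rightarrow> real ^ 'd) \<Rightarrow> real \<Rightarrow> real ^ 'd \<Rightarrow> real" where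
  "norm_drift m b \<sigma> \<eta> z =
     z \<bullet> rescale b \<eta> z + 1 / 2 * (\<Sum>k = 1..m. (norm (rescale (\<sigma> k) \<eta> z))\<^sup>2)
     - (\<Sum>k = 1..m. (z \<bullet> rescale (\<sigma> k) \<eta> z)\<^sup>2)"

text \<open>One step of the scheme from the state \<open>(\<eta>, z)\<close>; \<open>w k\<close> is the value of the \<open>k\<close>-th noise
  variable used in this step.\<close>

definition norm_step ::
  "nat \<Rightarrow> (real ^ 'd \<Rightarrow> real ^ 'd) \<Rightarrow> (nat \<Rightarrow> real ^ 'd \<Rightarrow> real ^ 'd) \<Rightarrow> real \<Rightarrow> (nat \<Rightarrow> real)
     \<Rightarrow> real \<Rightarrow> real ^ 'd \<Rightarrow> real" where
  "norm_step m b \<sigma> \<Delta> w \<eta> z =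
     \<eta> * exp (norm_drift m b \<sigma> \<eta> z * \<Delta> + (\<Sum>k = 1..m. (z \<bullet> rescale (\<sigma> k) \<eta> z) * sqrt \<Delta> * w k))"

definition pre_direction_step ::
  "nat \<Rightarrow> (real ^ 'd \<Rightarrow> real ^ 'd) \<Rightarrow> (nat \<Rightarrow> real ^ 'd \<Rightarrow> real ^ 'd) \<Rightarrow> real \<Rightarrow> (nat \<Rightarrow> real)
     \<Rightarrow> real \<Rightarrow> real ^ 'd \<Rightarrow> real ^ 'd" where
  "pre_direction_step m b \<sigma> \<Delta> w \<eta> z =
     z + \<Delta> *\<^sub>R (rescale b \<eta> z - (z \<bullet> rescale b \<eta> z) *\<^sub>R z + Psi m \<sigma> \<eta> z)
       + (\<Sum>k = 1..m. (sqrt \<Delta> * w k) *\<^sub>R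
            (rescale (\<sigma> k) \<eta> z - (z \<bullet> rescale (\<sigma> k) \<eta> z) *\<^sub>R z))"

definition direction_step ::
  "nat \<Rightarrow> (real ^ 'd \<Rightarrow> real ^ 'd) \<Rightarrow> (nat \<Rightarrow> real ^ 'd \<Rightarrow> real ^ 'd) \<Rightarrow> real \<Rightarrow> (nat \<Rightarrow> real)
     \<Rightarrow> real \<Rightarrow> real ^ 'd \<Rightarrow> real ^ 'd" where
  "direction_step m b \<sigma> \<Delta> w \<eta> z =
     (let y = pre_direction_step m b \<sigma> \<Delta> w \<eta> z
      in if y \<noteq> 0 then (1 / norm y) *\<^sub>R y else z)"

text \<open>The scheme along one path of the noise: \<open>w k n\<close> is the value of $\hat W^k_n$ (only
  $n \ge 1$ is used), and the \<open>n\<close>-th state is the pair $(\bar\eta_n, \hat Z_n)$.\<close>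

primrec dn_scheme ::
  "nat \<Rightarrow> (real ^ 'd \<Rightarrow> real ^ 'd) \<Rightarrow> (nat \<Rightarrow> real ^ 'd \<Rightarrow> real ^ 'd) \<Rightarrow> real \<Rightarrow> (nat \<Rightarrow> nat \<Rightarrow> real)
     \<Rightarrow> real \<Rightarrow> real ^ 'd \<Rightarrow> nat \<Rightarrow> real \<times> (real ^ 'd)" where
  "dn_scheme m b \<sigma> \<Delta> w \<eta>\<^sub>0 z\<^sub>0 0 = (\<eta>\<^sub>0, z\<^sub>0)"
| "dn_scheme m b \<sigma> \<Delta> w \<eta>\<^sub>0 z\<^sub>0 (Suc n) =
     (let (\<eta>, z) = dn_scheme m b \<sigma> \<Delta> w \<eta>\<^sub>0 z\<^sub>0 n
      in (norm_step m b \<sigma> \<Delta> (\<lambda>k. w k (Suc n)) \<eta> z,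
          direction_step m b \<sigma> \<Delta> (\<lambda>k. w k (Suc n)) \<eta> z))"

definition dn_approx ::
  "nat \<Rightarrow> (real ^ 'd \<Rightarrow> real ^ 'd) \<Rightarrow> (nat \<Rightarrow> real ^ 'd \<Rightarrow> real ^ 'd) \<Rightarrow> real \<Rightarrow> (nat \<Rightarrow> nat \<Rightarrow> real)
     \<Rightarrow> real \<Rightarrow> real ^ 'd \<Rightarrow> nat \<Rightarrow> real ^ 'd" where
  "dn_approx m b \<sigma> \<Delta> w \<eta>\<^sub>0 z\<^sub>0 n =
     fst (dn_scheme m b \<sigma> \<Delta> w \<eta>\<^sub>0 z\<^sub>0 n) *\<^sub>R snd (dn_scheme m b \<sigma> \<Delta> w \<eta>\<^sub>0 z\<^sub>0 n)"

text \<open>Independence of two random elements whose value types may differ; the library's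
  \<open>indep_var\<close> requires both to have the same type.\<close>

definition indep_rvs :: "'a measure \<Rightarrow> 'b measure \<Rightarrow> ('a \<Rightarrow> 'b) \<Rightarrow> 'c measure \<Rightarrow> ('a \<Rightarrow> 'c) \<Rightarrow> bool" where
  "indep_rvs M S X T Y \<longleftrightarrow>
     X \<in> measurable M S \<and> Y \<in> measurable M T \<and>
     prob_space.indep_set M {X -` A \<inter> space M | A. A \<in> sets S} {Y -` B \<inter> space M | B. B \<in> sets T}"

end

theory Submission
  imports Defs "HOL-Library.Discrete_Functions"
begin

text \<open>
  The scheme keeps \<open>\<eta> > 0\<close> and the direction on the unit sphere, so the norm of the approximation is
  its component \<open>\<eta>\<close>, whatever the direction does. As \<open>\<eta>\<close> is updated by multiplication with an
  exponential, \<open>ln_dn_scheme\<close> writes \<open>ln \<eta>\<^sub>n\<close> exactly as \<open>ln \<eta>\<^sub>0\<close>, plus \<open>\<Delta>\<close> times the sum of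
  the drifts, plus a noise term \<open>S\<^sub>n\<close>. By \<open>norm_drift_eq\<close> each drift is a value of the function whose
  supremum is \<open>-\<lambda>\<close>. Dividing by \<open>n \<Delta>\<close>, the first two contributions have an upper limit of at most
  \<open>-\<lambda>\<close>, and it remains to see that \<open>S\<^sub>n / n\<close> tends to zero almost surely.

  The increments of \<open>S\<^sub>n\<close> are combinations of the fresh noise variables with coefficients that are
  determined by the past and bounded, thanks to the linear growth of the \<open>\<sigma>\<^sup>k\<close>, by \<open>K sqrt \<Delta>\<close>.
  The noise is centred because its law is symmetric, and independent of the past
  (\<open>indep_history_noise\<close>, with \<open>dn_scheme_measurable\<close> for the adaptedness of the scheme). So the
  increments are orthogonal with bounded second moments (\<open>predictable_noise_average_tendsto_0\<close>), and
  for such variables a strong law follows from second moments alone: convergence along the squares, and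
  control of the gaps between them (\<open>strong_law_orthogonal\<close>).
\<close>

section \<open>Continuity and measurability of the coefficients and of the scheme\<close>

text \<open>Continuity is what makes the coefficients Borel measurable. It is a local Lipschitz estimate:
  on a closed ball around \<open>x\<close> all partial derivatives are bounded by one constant, by compactness,
  and a point of the ball is moved to \<open>x\<close> by correcting one coordinate at a time, each correction
  costing at most that constant times its length.\<close>

lemma has_continuous_partials_imp_continuous_on:
  fixes f :: "real ^ 'd \<Rightarrow> real ^ 'd"
  assumes "has_continuous_partials f"
  shows "continuous_on UNIV f"
proof -
  obtain D where contD: "\<And>j. continuous_on UNIV (D j)"
    and derivD: "\<And>j x. ((\<lambda>t. f (x + t *\<^sub>R axis j 1)) has_vector_derivative D j x) (at 0)"
    using assms unfolding has_continuous_partials_def by metis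
  have "isCont f x" for x
  proof -
    have "\<exists>B. \<forall>u \<in> cball x 1. norm (D j u) \<le> B" for j
    proof -
      have "compact (D j ` cball x 1)"
        by (intro compact_continuous_image continuous_on_subset[OF contD]) auto
      then show ?thesis
        using compact_imp_bounded bounded_iff by (metis image_eqI)
    qed
    then obtain B where B: "\<And>j u. u \<in> cball x 1 \<Longrightarrow> norm (D j u) \<le> B j"
      by metis
    define C where "C = (\<Sum>j\<in>UNIV. \<bar>B j\<bar>)"
    have C: "norm (D j u) \<le> C" if "u \<in> cball x 1" for j u
    proof -
      have "norm (D j u) \<le> \<bar>B j\<bar>" using B[OF that, of j] by simp
      also have "\<dots> \<le> C" unfolding C_def by (rule member_le_sum) auto
      finally show ?thesis .
    qed
    have "0 \<le> C" unfolding C_def by (rule sum_nonneg) auto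
    have step: "norm (f (u + s *\<^sub>R axis j 1) - f u) \<le> C * \<bar>s\<bar>"
      if u: "u \<in> cball x 1" and us: "u + s *\<^sub>R axis j 1 \<in> cball x 1" for u s j
    proof -
      let ?g = "\<lambda>t. f (u + t *\<^sub>R axis j 1)"
      have deriv: "(?g has_vector_derivative D j (u + t *\<^sub>R axis j 1)) (at t)" for t
      proof -
        have "((\<lambda>r. f ((u + t *\<^sub>R axis j 1) + r *\<^sub>R axis j 1)) \<circ> (\<lambda>r. r - t)
            has_vector_derivative 1 *\<^sub>R D j (u + t *\<^sub>R axis j 1)) (at t)"
          by (rule vector_diff_chain_at) (auto intro!: derivative_eq_intros derivD)
        then show ?thesis
          by (simp add: o_def algebra_simps)
      qed
      have seg: "u + t *\<^sub>R axis j 1 \<in> cball x 1" if t: "t \<in> closed_segment 0 s" for t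
      proof -
        obtain a where a: "0 \<le> a" "a \<le> 1" and "t = (1 - a) *\<^sub>R 0 + a *\<^sub>R s"
          using t unfolding in_segment(1) by blast
        then have "t = a * s" by simp
        have "u + t *\<^sub>R axis j 1 = (1 - a) *\<^sub>R u + a *\<^sub>R (u + s *\<^sub>R axis j 1)"
          by (simp add: \<open>t = a * s\<close> algebra_simps)
        also have "\<dots> \<in> cball x 1"
          using a by (intro convexD_alt[OF convex_cball] u us) auto
        finally show ?thesis .
      qed
      have "norm (?g s - ?g 0) \<le> C * norm (s - 0)"
      proof (rule differentiable_bound[OF convex_closed_segment[of 0 s]])
        show "(?g has_derivative (\<lambda>h. h *\<^sub>R D j (u + t *\<^sub>R axis j 1))) (at t within closed_segment 0 s)" for t
          using deriv[of t] unfolding has_vector_derivative_def by (rule has_derivative_at_withinI)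
        show "onorm (\<lambda>h. h *\<^sub>R D j (u + t *\<^sub>R axis j 1)) \<le> C" if "t \<in> closed_segment 0 s" for t
        proof (rule onorm_le)
          fix h :: real
          have "norm (h *\<^sub>R D j (u + t *\<^sub>R axis j 1)) = norm (D j (u + t *\<^sub>R axis j 1)) * norm h"
            by simp
          also have "\<dots> \<le> C * norm h"
            by (intro mult_right_mono C[OF seg[OF that]]) simp
          finally show "norm (h *\<^sub>R D j (u + t *\<^sub>R axis j 1)) \<le> C * norm h" .
        qed
      qed (rule ends_in_segment)+
      then show ?thesis by simp
    qed
    have coord: "norm (f y - f x) \<le> C * card S * norm (y - x)"
      if "finite S" "\<And>j. j \<notin> S \<Longrightarrow> y $ j = x $ j" "norm (y - x) \<le> 1" for S y
      using that
    proof (induction S arbitrary: y rule: finite_induct)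
      case empty
      then have "y = x" by (simp add: vec_eq_iff)
      then show ?case by simp
    next
      case (insert j S)
      define u where "u = (\<chi> i. if i = j then x $ j else y $ i)"
      have y: "y = u + (y $ j - x $ j) *\<^sub>R axis j 1"
        by (simp add: vec_eq_iff u_def axis_def)
      have ux: "norm (u - x) \<le> norm (y - x)"
        by (rule norm_le_componentwise_cart) (simp add: u_def)
      have "norm (f u - f x) \<le> C * card S * norm (u - x)"
        using insert.prems ux by (intro insert.IH) (auto simp: u_def)
      also have "\<dots> \<le> C * card S * norm (y - x)"
        using ux \<open>0 \<le> C\<close> by (intro mult_left_mono) auto
      finally have 1: "norm (f u - f x) \<le> C * card S * norm (y - x)" .
      have "norm (f y - f u) \<le> C * \<bar>y $ j - x $ j\<bar>"
        using step[of u "y $ j - x $ j" j] y ux insert.prems(2)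
        by (simp add: dist_norm norm_minus_commute)
      also have "\<dots> \<le> C * norm (y - x)"
        using component_le_norm_cart[of "y - x" j] \<open>0 \<le> C\<close> by (intro mult_left_mono) auto
      finally have 2: "norm (f y - f u) \<le> C * norm (y - x)" .
      have "norm (f y - f x) \<le> norm (f y - f u) + norm (f u - f x)"
        using norm_triangle_ineq[of "f y - f u" "f u - f x"] by simp
      also have "\<dots> \<le> C * norm (y - x) + C * card S * norm (y - x)"
        using 1 2 by simp
      also have "\<dots> = C * card (insert j S) * norm (y - x)"
        using insert.hyps by (simp add: algebra_simps)
      finally show ?case .
    qed
    have "(\<lambda>y. f y - f x) \<midarrow>x\<rightarrow> 0"
    proof (rule Lim_null_comparison)
      show "\<forall>\<^sub>F y in at x. norm (f y - f x) \<le> C * CARD('d) * norm (y - x)"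
        unfolding eventually_at
        by (rule exI[of _ 1]) (auto simp: dist_norm intro: coord[of UNIV, simplified])
      show "(\<lambda>y. C * CARD('d) * norm (y - x)) \<midarrow>x\<rightarrow> 0"
        by (auto intro!: tendsto_eq_intros)
    qed
    then show ?thesis
      by (simp add: isCont_def LIM_zero_iff)
  qed
  then show ?thesis by (simp add: continuous_at_imp_continuous_on)
qed

lemma borel_measurable_rescale [measurable]:
  assumes f [measurable]: "f \<in> borel_measurable borel"
    and [measurable]: "\<eta> \<in> borel_measurable N" "z \<in> borel_measurable N"
  shows "(\<lambda>x. rescale f (\<eta> x) (z x)) \<in> borel_measurable N"
proof -
  have [measurable]: "(\<lambda>v. jacobian f (at 0) *v v) \<in> borel_measurable borel"
    by (intro borel_measurable_continuous_onI linear_continuous_on) simp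
  show ?thesis
    unfolding rescale_def by measurable
qed

text \<open>The state after \<open>n\<close> steps reads only the noise up to time \<open>n\<close>. Since \<open>N\<close> is arbitrary,
  it can be taken to be the \<open>\<sigma>\<close>-algebra of the past, so that this lemma is the adaptedness of the
  scheme.\<close>

lemma dn_scheme_measurable:
  assumes b [measurable]: "b \<in> borel_measurable borel"
    and \<sigma>: "\<And>k. k \<in> {1..m} \<Longrightarrow> \<sigma> k \<in> borel_measurable borel"
    and [measurable]: "\<eta>\<^sub>0 \<in> borel_measurable N" "z\<^sub>0 \<in> borel_measurable N"
    and w: "\<And>k i. k \<in> {1..m} \<Longrightarrow> i \<in> {1..n} \<Longrightarrow> w k i \<in> borel_measurable N"
  shows "(\<lambda>\<omega>. fst (dn_scheme m b \<sigma> \<Delta> (\<lambda>k i. w k i \<omega>) (\<eta>\<^sub>0 \<omega>) (z\<^sub>0 \<omega>) n)) \<in> borel_measurable N"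
    and "(\<lambda>\<omega>. snd (dn_scheme m b \<sigma> \<Delta> (\<lambda>k i. w k i \<omega>) (\<eta>\<^sub>0 \<omega>) (z\<^sub>0 \<omega>) n)) \<in> borel_measurable N"
proof -
  let ?s = "\<lambda>n \<omega>. dn_scheme m b \<sigma> \<Delta> (\<lambda>k i. w k i \<omega>) (\<eta>\<^sub>0 \<omega>) (z\<^sub>0 \<omega>) n"
  have "(\<lambda>\<omega>. fst (?s n \<omega>)) \<in> borel_measurable N \<and> (\<lambda>\<omega>. snd (?s n \<omega>)) \<in> borel_measurable N"
    using w
  proof (induction n)
    case 0
    then show ?case by simp
  next
    case (Suc n)
    note \<sigma> [measurable]
    have [measurable]: "(\<lambda>\<omega>. fst (?s n \<omega>)) \<in> borel_measurable N"
      "(\<lambda>\<omega>. snd (?s n \<omega>)) \<in> borel_measurable N"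
      using Suc.IH Suc.prems by auto
    have [measurable]: "w k (Suc n) \<in> borel_measurable N" if "k \<in> {1..m}" for k
      using Suc.prems[OF that] by simp
    have 1: "(\<lambda>\<omega>. norm_step m b \<sigma> \<Delta> (\<lambda>k. w k (Suc n) \<omega>) (fst (?s n \<omega>)) (snd (?s n \<omega>)))
        \<in> borel_measurable N"
      unfolding norm_step_def norm_drift_def by measurable
    have [measurable]: "(\<lambda>\<omega>. pre_direction_step m b \<sigma> \<Delta> (\<lambda>k. w k (Suc n) \<omega>) (fst (?s n \<omega>)) (snd (?s n \<omega>)))
        \<in> borel_measurable N"
      unfolding pre_direction_step_def Psi_def by measurable
    have 2: "(\<lambda>\<omega>. direction_step m b \<sigma> \<Delta> (\<lambda>k. w k (Suc n) \<omega>) (fst (?s n \<omega>)) (snd (?s n \<omega>)))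
        \<in> borel_measurable N"
      unfolding direction_step_def Let_def by measurable
    from 1 2 show ?case by (simp add: case_prod_beta Let_def)
  qed
  then show "(\<lambda>\<omega>. fst (?s n \<omega>)) \<in> borel_measurable N" "(\<lambda>\<omega>. snd (?s n \<omega>)) \<in> borel_measurable N"
    by auto
qed

section \<open>The logarithm of the norm along a path\<close>

lemma dn_scheme_pos_unit:
  assumes "\<eta>\<^sub>0 > 0" "norm z\<^sub>0 = 1"
  shows "fst (dn_scheme m b \<sigma> \<Delta> w \<eta>\<^sub>0 z\<^sub>0 n) > 0" "norm (snd (dn_scheme m b \<sigma> \<Delta> w \<eta>\<^sub>0 z\<^sub>0 n)) = 1"
proof -
  have "fst (dn_scheme m b \<sigma> \<Delta> w \<eta>\<^sub>0 z\<^sub>0 n) > 0 \<and> norm (snd (dn_scheme m b \<sigma> \<Delta> w \<eta>\<^sub>0 z\<^sub>0 n)) = 1"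
    using assms by (induction n) (auto simp: case_prod_beta norm_step_def direction_step_def Let_def)
  then show "fst (dn_scheme m b \<sigma> \<Delta> w \<eta>\<^sub>0 z\<^sub>0 n) > 0" "norm (snd (dn_scheme m b \<sigma> \<Delta> w \<eta>\<^sub>0 z\<^sub>0 n)) = 1"
    by auto
qed

lemma norm_rescale_le:
  assumes "\<And>x. norm (f x) \<le> K * norm x" "\<eta> > 0" "norm z = 1"
  shows "norm (rescale f \<eta> z) \<le> K"
  using assms(1)[of "\<eta> *\<^sub>R z"] assms(2,3) by (simp add: rescale_def divide_simps mult.commute)

text \<open>The powers of \<open>\<eta> = norm x\<close> by which the coefficients are rescaled, and those by which \<open>z\<close>
  differs from \<open>x\<close>, combine to the denominators on the right. Hence the drift of the log-norm is a
  value of the function whose supremum is \<open>-\<lambda>\<close>, and is at most \<open>-\<lambda>\<close> on every path with positive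
  initial norm and a unit initial direction.\<close>

lemma norm_drift_eq:
  fixes \<eta> :: real
  assumes "\<eta> > 0" "norm z = 1"
  defines "x \<equiv> \<eta> *\<^sub>R z"
  shows "norm_drift m b \<sigma> \<eta> z = (x \<bullet> b x + 1 / 2 * (\<Sum>k = 1..m. (norm (\<sigma> k x))\<^sup>2)) / (norm x)\<^sup>2
          - (\<Sum>k = 1..m. (x \<bullet> \<sigma> k x)\<^sup>2) / (norm x) ^ 4"
proof -
  have nx: "norm x = \<eta>" using assms by simp
  have "z \<bullet> rescale b \<eta> z = (x \<bullet> b x) / (norm x)\<^sup>2"
    unfolding nx using assms(1) by (simp add: x_def rescale_def power2_eq_square)
  moreover have "(norm (rescale (\<sigma> k) \<eta> z))\<^sup>2 = (norm (\<sigma> k x))\<^sup>2 / (norm x)\<^sup>2" for k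
    unfolding nx using assms(1) by (simp add: x_def rescale_def power_divide)
  moreover have "(z \<bullet> rescale (\<sigma> k) \<eta> z)\<^sup>2 = (x \<bullet> \<sigma> k x)\<^sup>2 / (norm x) ^ 4" for k
    unfolding nx using assms(1) by (simp add: x_def rescale_def field_simps power2_eq_square power4_eq_xxxx)
  ultimately show ?thesis
    unfolding norm_drift_def by (simp add: sum_divide_distrib[symmetric] add_divide_distrib)
qed

text \<open>The norm component is multiplied by an exponential in each step, so its logarithm is a sum, and
  no discretization error enters. This is why the step-size may be arbitrary.\<close>

lemma ln_dn_scheme:
  fixes b :: "real ^ 'd \<Rightarrow> real ^ 'd" and w :: "nat \<Rightarrow> nat \<Rightarrow> real" and \<Delta> :: real
    and m :: nat and \<sigma> :: "nat \<Rightarrow> real ^ 'd \<Rightarrow> real ^ 'd"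
  assumes "\<eta>\<^sub>0 > 0" "norm z\<^sub>0 = 1"
  defines "\<eta> \<equiv> \<lambda>i. fst (dn_scheme m b \<sigma> \<Delta> w \<eta>\<^sub>0 z\<^sub>0 i)"
    and "z \<equiv> \<lambda>i. snd (dn_scheme m b \<sigma> \<Delta> w \<eta>\<^sub>0 z\<^sub>0 i)"
  shows "ln (\<eta> n) = ln \<eta>\<^sub>0 + (\<Sum>i<n. norm_drift m b \<sigma> (\<eta> i) (z i)) * \<Delta>
     + (\<Sum>i<n. \<Sum>k = 1..m. ((z i \<bullet> rescale (\<sigma> k) (\<eta> i) (z i)) * sqrt \<Delta>) * w k (Suc i))"
proof (induction n)
  case 0
  then show ?case by (simp add: \<eta>_def)
next
  case (Suc n)
  have "\<eta> n > 0" unfolding \<eta>_def by (rule dn_scheme_pos_unit[OF assms(1,2)])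
  have "\<eta> (Suc n) = norm_step m b \<sigma> \<Delta> (\<lambda>k. w k (Suc n)) (\<eta> n) (z n)"
    by (simp add: \<eta>_def z_def case_prod_beta Let_def)
  then show ?case
    using \<open>\<eta> n > 0\<close> by (simp add: norm_step_def ln_mult Suc algebra_simps)
qed

section \<open>A strong law for orthogonal random variables\<close>

text \<open>By monotone convergence the series of the \<open>f n\<close> has finite expectation, hence converges almost
  surely.\<close>

lemma (in prob_space) nonneg_expectation_summable_imp_AE_tendsto_0:
  fixes f :: "nat \<Rightarrow> 'a \<Rightarrow> real"
  assumes int: "\<And>n. integrable M (f n)" and nonneg: "\<And>n \<omega>. 0 \<le> f n \<omega>"
    and le: "\<And>n. expectation (f n) \<le> a n" and a: "summable a"
  shows "AE \<omega> in M. (\<lambda>n. f n \<omega>) \<longlonglongrightarrow> 0"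
proof -
  have [measurable]: "f n \<in> borel_measurable M" for n using int by auto
  have E0: "0 \<le> expectation (f n)" for n using nonneg by simp
  have "summable (\<lambda>n. expectation (f n))"
    by (rule summable_comparison_test'[OF a, of 0]) (use E0 le in auto)
  have "(\<integral>\<^sup>+ \<omega>. (\<Sum>n. ennreal (f n \<omega>)) \<partial>M) = (\<Sum>n. \<integral>\<^sup>+ \<omega>. ennreal (f n \<omega>) \<partial>M)"
    by (rule nn_integral_suminf) measurable
  also have "\<dots> = (\<Sum>n. ennreal (expectation (f n)))"
    by (intro suminf_cong nn_integral_eq_integral int) (simp add: nonneg)
  also have "\<dots> \<noteq> \<infinity>"
    using suminf_ennreal2[OF E0 \<open>summable (\<lambda>n. expectation (f n))\<close>] by simp
  finally have "AE \<omega> in M. (\<Sum>n. ennreal (f n \<omega>)) \<noteq> \<infinity>"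
    by (intro nn_integral_PInf_AE) measurable
  then show ?thesis
  proof eventually_elim
    case (elim \<omega>)
    then have "summable (\<lambda>n. f n \<omega>)"
      by (intro summable_suminf_not_top) (auto simp: nonneg)
    then show ?case by (rule summable_LIMSEQ_zero)
  qed
qed

text \<open>Orthogonality makes second moments of partial sums additive, so that
  \<open>E (S\<^sub>n / n)\<^sup>2 \<le> C / n\<close>. This is summable along the squares, which gives
  convergence there. From \<open>n\<^sup>2\<close> up to the next square, the largest squared increment of the
  partial sums is bounded crudely by the sum of all of them: there are \<open>2 n + 1\<close> such increments,
  each with second moment at most \<open>C (2 n + 1)\<close>, and after division by \<open>n\<^sup>4\<close> this is
  summable as well.\<close>

lemma (in prob_space) strong_law_orthogonal:
  fixes X :: "nat \<Rightarrow> 'a \<Rightarrow> real"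
  assumes [measurable]: "\<And>i. X i \<in> borel_measurable M"
    and sq: "\<And>i. integrable M (\<lambda>\<omega>. (X i \<omega>)\<^sup>2)"
    and le: "\<And>i. expectation (\<lambda>\<omega>. (X i \<omega>)\<^sup>2) \<le> C"
    and orth: "\<And>i j. i < j \<Longrightarrow> expectation (\<lambda>\<omega>. X i \<omega> * X j \<omega>) = 0"
  shows "AE \<omega> in M. (\<lambda>n. (\<Sum>i<n. X i \<omega>) / n) \<longlonglongrightarrow> 0"
proof -
  have orth': "expectation (\<lambda>\<omega>. X i \<omega> * X j \<omega>) = (if i = j then expectation (\<lambda>\<omega>. (X i \<omega>)\<^sup>2) else 0)" for i j
    using orth[of i j] orth[of j i] by (cases i j rule: linorder_cases) (auto simp: power2_eq_square mult.commute)
  have int_prod: "integrable M (\<lambda>\<omega>. X i \<omega> * X j \<omega>)" for i j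
  proof (rule Bochner_Integration.integrable_bound)
    show "integrable M (\<lambda>\<omega>. (X i \<omega>)\<^sup>2 + (X j \<omega>)\<^sup>2)" using sq by simp
    have "\<bar>x * y\<bar> \<le> x\<^sup>2 + y\<^sup>2" for x y :: real
    proof -
      have "2 * \<bar>x\<bar> * \<bar>y\<bar> \<le> x\<^sup>2 + y\<^sup>2"
        using sum_squares_bound[of "\<bar>x\<bar>" "\<bar>y\<bar>"] by simp
      moreover have "0 \<le> \<bar>x\<bar> * \<bar>y\<bar>" by simp
      ultimately show ?thesis unfolding abs_mult by linarith
    qed
    then show "AE \<omega> in M. norm (X i \<omega> * X j \<omega>) \<le> norm ((X i \<omega>)\<^sup>2 + (X j \<omega>)\<^sup>2)"
      by simp
  qed measurable
  have square: "(\<Sum>i\<in>A. X i \<omega>)\<^sup>2 = (\<Sum>i\<in>A. \<Sum>j\<in>A. X i \<omega> * X j \<omega>)" for A \<omega>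
    by (simp add: power2_eq_square sum_product)
  have int_sum: "integrable M (\<lambda>\<omega>. (\<Sum>i\<in>A. X i \<omega>)\<^sup>2)" for A
    unfolding square by (intro Bochner_Integration.integrable_sum int_prod)
  have E_sum: "expectation (\<lambda>\<omega>. (\<Sum>i\<in>A. X i \<omega>)\<^sup>2) \<le> C * card A" if "finite A" for A
  proof -
    have "expectation (\<lambda>\<omega>. (\<Sum>i\<in>A. X i \<omega>)\<^sup>2) = (\<Sum>i\<in>A. \<Sum>j\<in>A. expectation (\<lambda>\<omega>. X i \<omega> * X j \<omega>))"
      unfolding square using int_prod by simp
    also have "\<dots> = (\<Sum>i\<in>A. expectation (\<lambda>\<omega>. (X i \<omega>)\<^sup>2))"
      using that by (simp add: orth')
    also have "\<dots> \<le> (\<Sum>i\<in>A. C)" by (intro sum_mono le)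
    finally show ?thesis by (simp add: mult.commute)
  qed
  define S where "S n \<omega> = (\<Sum>i<n. X i \<omega>)" for n \<omega>
  \<comment> \<open>\<open>2 * Q n\<close> bounds \<open>(S k / k)\<^sup>2\<close> for every \<open>k\<close> from \<open>n\<^sup>2\<close> up to the next square; at
    \<open>n = 0\<close> the division by zero makes \<open>Q\<close> vanish.\<close>
  define Q where "Q n \<omega> = ((S (n\<^sup>2) \<omega>)\<^sup>2 + (\<Sum>k\<in>{n\<^sup>2..<(Suc n)\<^sup>2}. (\<Sum>i\<in>{n\<^sup>2..<k}. X i \<omega>)\<^sup>2)) / real n ^ 4" for n \<omega>
  have "0 \<le> C" by (rule order_trans[OF _ le[of 0]]) simp
  have "AE \<omega> in M. (\<lambda>n. Q n \<omega>) \<longlonglongrightarrow> 0"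
  proof (rule nonneg_expectation_summable_imp_AE_tendsto_0)
    show "integrable M (Q n)" for n
      unfolding Q_def S_def by (intro integrable_divide_zero Bochner_Integration.integrable_add Bochner_Integration.integrable_sum int_sum)
    show "0 \<le> Q n \<omega>" for n \<omega>
      unfolding Q_def by (intro divide_nonneg_nonneg add_nonneg_nonneg sum_nonneg) auto
    show "summable (\<lambda>n. 10 * C * inverse (real n ^ 2))"
      by (intro summable_mult inverse_power_summable) simp
    show "expectation (Q n) \<le> 10 * C * inverse (real n ^ 2)" for n
    proof (cases "n = 0")
      case True
      have "Q 0 = (\<lambda>_. 0)" by (simp add: Q_def fun_eq_iff)
      with True show ?thesis by simp
    next
      case False
      have len: "(Suc n)\<^sup>2 - n\<^sup>2 = 2 * n + 1"
        by (simp add: power2_eq_square)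
      have "expectation (Q n) = (expectation (\<lambda>\<omega>. (\<Sum>i<n\<^sup>2. X i \<omega>)\<^sup>2)
          + (\<Sum>k\<in>{n\<^sup>2..<(Suc n)\<^sup>2}. expectation (\<lambda>\<omega>. (\<Sum>i\<in>{n\<^sup>2..<k}. X i \<omega>)\<^sup>2))) / real n ^ 4"
        unfolding Q_def S_def using int_sum by simp
      also have "\<dots> \<le> (C * n\<^sup>2 + (\<Sum>k\<in>{n\<^sup>2..<(Suc n)\<^sup>2}. C * (2 * n + 1))) / real n ^ 4"
      proof (intro divide_right_mono add_mono sum_mono)
        show "expectation (\<lambda>\<omega>. (\<Sum>i<n\<^sup>2. X i \<omega>)\<^sup>2) \<le> C * real (n\<^sup>2)"
          using E_sum[of "{..<n\<^sup>2}"] by simp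
        fix k assume k: "k \<in> {n\<^sup>2..<(Suc n)\<^sup>2}"
        have "expectation (\<lambda>\<omega>. (\<Sum>i\<in>{n\<^sup>2..<k}. X i \<omega>)\<^sup>2) \<le> C * real (k - n\<^sup>2)"
          using E_sum[of "{n\<^sup>2..<k}"] by simp
        also have "k - n\<^sup>2 \<le> 2 * n + 1" using k len by auto
        then have "C * real (k - n\<^sup>2) \<le> C * real (2 * n + 1)"
          using \<open>0 \<le> C\<close> by (intro mult_left_mono) auto
        finally show "expectation (\<lambda>\<omega>. (\<Sum>i\<in>{n\<^sup>2..<k}. X i \<omega>)\<^sup>2) \<le> C * real (2 * n + 1)" .
      qed simp
      also have "\<dots> = C * (real n ^ 2 + (2 * real n + 1) ^ 2) / real n ^ 4"
        using len by (simp add: algebra_simps power2_eq_square)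
      also have "\<dots> \<le> C * (10 * real n ^ 2) / real n ^ 4"
      proof (intro divide_right_mono mult_left_mono)
        have "2 * real n + 1 \<le> 3 * real n" using False by simp
        then have "(2 * real n + 1)\<^sup>2 \<le> (3 * real n)\<^sup>2" by (intro power_mono) auto
        then show "(real n)\<^sup>2 + (2 * real n + 1)\<^sup>2 \<le> 10 * (real n)\<^sup>2"
          by (simp add: power_mult_distrib)
      qed (use \<open>0 \<le> C\<close> in auto)
      also have "\<dots> = 10 * C * inverse (real n ^ 2)"
        using False by (simp add: field_simps power2_eq_square power4_eq_xxxx)
      finally show ?thesis .
    qed
  qed
  then show ?thesis
  proof eventually_elim
    case (elim \<omega>)
    have bound: "(S n \<omega> / n)\<^sup>2 \<le> 2 * Q (floor_sqrt n) \<omega>" if "n > 0" for n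
    proof -
      define p where "p = floor_sqrt n"
      have p: "p\<^sup>2 \<le> n" "n < (Suc p)\<^sup>2" "0 < p"
        using Suc_floor_sqrt_power2_gt[of n] that by (auto simp: p_def)
      have split: "S n \<omega> = S (p\<^sup>2) \<omega> + (\<Sum>i\<in>{p\<^sup>2..<n}. X i \<omega>)"
        unfolding S_def lessThan_atLeast0 using p by (simp add: sum.atLeastLessThan_concat)
      have "(\<Sum>i\<in>{p\<^sup>2..<n}. X i \<omega>)\<^sup>2 \<le> (\<Sum>k\<in>{p\<^sup>2..<(Suc p)\<^sup>2}. (\<Sum>i\<in>{p\<^sup>2..<k}. X i \<omega>)\<^sup>2)"
        using p by (intro member_le_sum[where f="\<lambda>k. (\<Sum>i\<in>{p\<^sup>2..<k}. X i \<omega>)\<^sup>2"]) auto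
      moreover have "(x + y)\<^sup>2 \<le> 2 * (x\<^sup>2 + y\<^sup>2)" for x y :: real
        using sum_squares_bound[of x y] by (simp add: power2_sum)
      ultimately have num: "(S n \<omega>)\<^sup>2 \<le> 2 * ((S (p\<^sup>2) \<omega>)\<^sup>2 + (\<Sum>k\<in>{p\<^sup>2..<(Suc p)\<^sup>2}. (\<Sum>i\<in>{p\<^sup>2..<k}. X i \<omega>)\<^sup>2))"
        unfolding split by (smt (verit))
      have "real p ^ 4 \<le> (real n)\<^sup>2"
      proof -
        have "(real (p\<^sup>2))\<^sup>2 \<le> (real n)\<^sup>2" using p by (intro power_mono) auto
        then show ?thesis by simp
      qed
      then have "(S n \<omega>)\<^sup>2 / (real n)\<^sup>2 \<le> 2 * ((S (p\<^sup>2) \<omega>)\<^sup>2 + (\<Sum>k\<in>{p\<^sup>2..<(Suc p)\<^sup>2}. (\<Sum>i\<in>{p\<^sup>2..<k}. X i \<omega>)\<^sup>2)) / real p ^ 4"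
        using p(3) by (intro frac_le num order_trans[OF zero_le_power2 num]) auto
      then show ?thesis
        unfolding p_def[symmetric] Q_def power_divide by simp
    qed
    have "filterlim floor_sqrt at_top at_top"
      unfolding filterlim_at_top
      by (intro allI eventually_sequentiallyI) (rule le_floor_sqrtI)
    then have "(\<lambda>n. 2 * Q (floor_sqrt n) \<omega>) \<longlonglongrightarrow> 2 * 0"
      by (intro tendsto_mult tendsto_const filterlim_compose[OF elim])
    then have lim: "(\<lambda>n. 2 * Q (floor_sqrt n) \<omega>) \<longlonglongrightarrow> 0"
      by simp
    have "(\<lambda>n. (S n \<omega> / n)\<^sup>2) \<longlonglongrightarrow> 0"
    proof (rule Lim_null_comparison[OF _ lim], rule eventually_mono[OF eventually_gt_at_top[of 0]])
      fix n :: nat assume "n > 0"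
      then show "norm ((S n \<omega> / n)\<^sup>2) \<le> 2 * Q (floor_sqrt n) \<omega>"
        using bound by simp
    qed
    then have "(\<lambda>n. sqrt ((S n \<omega> / n)\<^sup>2)) \<longlonglongrightarrow> sqrt 0"
      by (rule tendsto_real_sqrt)
    then have "(\<lambda>n. \<bar>S n \<omega> / n\<bar>) \<longlonglongrightarrow> 0"
      by (simp only: real_sqrt_abs real_sqrt_zero)
    then have "(\<lambda>n. S n \<omega> / n) \<longlonglongrightarrow> 0"
      by (rule tendsto_rabs_zero_cancel)
    then show ?case unfolding S_def .
  qed
qed

section \<open>Independence of the past and the next noise\<close>

text \<open>The \<open>\<sigma>\<close>-algebra generated by the initial value \<open>X\<close> and the noise variables \<open>Y j\<close> with
  \<open>j \<in> J\<close>, on the space of \<open>M\<close>. As a measure it is the null measure; only its measurable sets matter.\<close>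

definition history ::
  "'a measure \<Rightarrow> 'b measure \<Rightarrow> ('a \<Rightarrow> 'b) \<Rightarrow> ('i \<Rightarrow> 'c measure) \<Rightarrow> ('i \<Rightarrow> 'a \<Rightarrow> 'c) \<Rightarrow> 'i set \<Rightarrow> 'a measure" where
  "history M S X N Y J = sigma (space M)
     ({X -` A \<inter> space M | A. A \<in> sets S} \<union> (\<Union>j\<in>J. {Y j -` A \<inter> space M | A. A \<in> sets (N j)}))"

lemma space_history [simp]: "space (history M S X N Y J) = space M"
  unfolding history_def by (rule space_measure_of) auto

lemma sets_history:
  "sets (history M S X N Y J) = sigma_sets (space M)
     ({X -` A \<inter> space M | A. A \<in> sets S} \<union> (\<Union>j\<in>J. {Y j -` A \<inter> space M | A. A \<in> sets (N j)}))"
  unfolding history_def by (rule sets_measure_of) auto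

lemma initial_measurable_history:
  "X \<in> measurable M S \<Longrightarrow> X \<in> measurable (history M S X N Y J) S"
  by (rule measurableI) (auto simp: sets_history dest: measurable_space)

lemma noise_measurable_history:
  "j \<in> J \<Longrightarrow> Y j \<in> measurable M (N j) \<Longrightarrow> Y j \<in> measurable (history M S X N Y J) (N j)"
  by (rule measurableI) (auto simp: sets_history dest: measurable_space)

lemma measurable_history_mono:
  assumes "J \<subseteq> J'"
  shows "measurable (history M S X N Y J) T \<subseteq> measurable (history M S X N Y J') T"
  by (rule measurable_mono) (auto simp: sets_history intro!: sigma_sets_mono' dest: subsetD[OF assms])

lemma history_measurable_imp_measurable:
  assumes "X \<in> measurable M S" "\<And>j. j \<in> J \<Longrightarrow> Y j \<in> measurable M (N j)"
    and "G \<in> measurable (history M S X N Y J) T"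
  shows "G \<in> measurable M T"
proof -
  have "measurable (history M S X N Y J) T \<subseteq> measurable M T"
    using assms(1,2) by (intro measurable_mono) (auto simp: sets_history intro!: sets.sigma_sets_subset)
  then show ?thesis using assms(3) by auto
qed

text \<open>What is determined by the initial value and some of the noise variables is independent of any
  other noise variable. The two hypotheses, independence of the initial value from the whole noise family
  and independence within the family, amount to independence of one family of set systems: the initial
  value contributes the index \<open>None\<close> and the noise variable \<open>j\<close> the index \<open>Some j\<close>. Grouping
  independent \<open>\<inter>\<close>-stable systems then preserves independence.\<close>

lemma (in prob_space) indep_history_noise:
  assumes init: "indep_rvs M S X (Pi\<^sub>M I N) (\<lambda>\<omega>. \<lambda>i\<in>I. Y i \<omega>)"
    and fam: "indep_vars N Y I"
    and J: "J \<subseteq> I" and l: "l \<in> I - J"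
    and G: "G \<in> measurable (history M S X N Y J) T"
  shows "indep_var T G (N l) (Y l)"
proof -
  define E where "E = case_option {X -` A \<inter> space M | A. A \<in> sets S}
    (\<lambda>j. {Y j -` A \<inter> space M | A. A \<in> sets (N j)})"
  have E_None: "E None = {X -` A \<inter> space M | A. A \<in> sets S}"
    and E_Some: "E (Some j) = {Y j -` A \<inter> space M | A. A \<in> sets (N j)}" for j
    by (auto simp: E_def)
  have X: "X \<in> measurable M S"
    using init by (simp add: indep_rvs_def)
  have Y: "Y i \<in> measurable M (N i)" if "i \<in> I" for i
    using fam that by (auto simp: indep_vars_def)
  have init_prob: "prob (A \<inter> B) = prob A * prob B"
    if "A \<in> E None" "B \<in> {(\<lambda>\<omega>. \<lambda>i\<in>I. Y i \<omega>) -` B \<inter> space M | B. B \<in> sets (Pi\<^sub>M I N)}" for A B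
    using init that unfolding indep_rvs_def indep_sets2_eq E_None by blast
  have fam_prob: "prob (\<Inter>j\<in>L. A j) = (\<Prod>j\<in>L. prob (A j))"
    if "L \<subseteq> I" "L \<noteq> {}" "finite L" "\<And>j. j \<in> L \<Longrightarrow> A j \<in> E (Some j)" for L A
    using fam that unfolding indep_vars_def2 indep_sets_def E_Some by (simp add: Pi_iff)
  have indep: "indep_sets E (insert None (Some ` I))"
    unfolding indep_sets_def
  proof (intro conjI ballI allI impI)
    show "E i \<subseteq> events" if "i \<in> insert None (Some ` I)" for i
      using that X Y by (auto simp: E_None E_Some intro: measurable_sets)
    fix L A assume L: "L \<subseteq> insert None (Some ` I)" "L \<noteq> {}" "finite L" and A: "A \<in> Pi L E"
    define L' where "L' = Some -` L"
    have L': "L' \<subseteq> I" "finite L'" using L by (auto simp: L'_def finite_vimageI)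
    have A': "A (Some j) \<in> E (Some j)" if "j \<in> L'" for j
      using A that by (auto simp: L'_def)
    have prod': "(\<Prod>i\<in>Some ` L'. prob (A i)) = (\<Prod>j\<in>L'. prob (A (Some j)))"
      by (simp add: prod.reindex)
    show "prob (\<Inter>i\<in>L. A i) = (\<Prod>i\<in>L. prob (A i))"
    proof (cases "None \<in> L")
      case False
      then have "L = Some ` L'"
        using L(1) by (auto simp: L'_def)
      then show ?thesis
        using fam_prob[of L' "\<lambda>j. A (Some j)"] L' A' L(2) prod' by auto
    next
      case True
      then have Leq: "L = insert None (Some ` L')"
        using L(1) by (auto simp: L'_def)
      have A_None: "A None \<in> E None" using A True by auto
      show ?thesis
      proof (cases "L' = {}")
        case True
        then show ?thesis by (simp add: Leq)
      next
        case False
        have "\<exists>B. B \<in> sets (N j) \<and> A (Some j) = Y j -` B \<inter> space M" if "j \<in> L'" for j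
          using A'[OF that] by (auto simp: E_Some)
        then obtain B where B: "\<And>j. j \<in> L' \<Longrightarrow> B j \<in> sets (N j)"
          "\<And>j. j \<in> L' \<Longrightarrow> A (Some j) = Y j -` B j \<inter> space M"
          by metis
        \<comment> \<open>A finite intersection of noise events is a cylinder event of the whole noise family, which is
          what independence of the initial value refers to.\<close>
        have "(\<Inter>j\<in>L'. A (Some j)) = (\<lambda>\<omega>. \<lambda>i\<in>I. Y i \<omega>) -` prod_emb I N L' (Pi\<^sub>E L' B) \<inter> space M"
          using False L'(1) B(2) measurable_space[OF Y]
          by (auto 4 3 simp: prod_emb_def PiE_iff restrict_def extensional_def space_PiM subset_eq)
        moreover have "prod_emb I N L' (Pi\<^sub>E L' B) \<in> sets (Pi\<^sub>M I N)"
          using L' B(1) by (intro sets_PiM_I) auto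
        ultimately have "prob (A None \<inter> (\<Inter>j\<in>L'. A (Some j))) = prob (A None) * prob (\<Inter>j\<in>L'. A (Some j))"
          by (intro init_prob A_None) blast
        then show ?thesis
          using fam_prob[of L' "\<lambda>j. A (Some j)"] L' A' False prod' by (simp add: Leq)
      qed
    qed
  qed
  \<comment> \<open>The two groups: the history on one side, the noise variable \<open>l\<close> on the other.\<close>
  let ?K = "case_bool (insert None (Some ` J)) {Some l}"
  have "indep_sets (\<lambda>j. sigma_sets (space M) (\<Union>i\<in>?K j. E i)) UNIV"
  proof (rule indep_sets_collect_sigma)
    show "indep_sets E (\<Union>j\<in>UNIV. ?K j)"
      by (rule indep_sets_mono_index[OF _ indep]) (use J l in \<open>auto simp: UNIV_bool\<close>)
    show "disjoint_family ?K"
      using l by (auto simp: disjoint_family_on_def split: bool.split)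
    have stable: "Int_stable {Z -` A \<inter> space M | A. A \<in> sets Q}" for Z :: "'a \<Rightarrow> 'x" and Q
    proof (rule Int_stableI, safe)
      fix A B assume "A \<in> sets Q" "B \<in> sets Q"
      then show "\<exists>C. Z -` A \<inter> space M \<inter> (Z -` B \<inter> space M) = Z -` C \<inter> space M \<and> C \<in> sets Q"
        by (intro exI[of _ "A \<inter> B"]) auto
    qed
    show "Int_stable (E i)" for i
      by (cases i) (auto simp: E_None E_Some intro!: stable)
  qed
  moreover have "(\<lambda>j. sigma_sets (space M) (\<Union>i\<in>?K j. E i)) =
      case_bool (sets (history M S X N Y J)) (sigma_sets (space M) (E (Some l)))"
    by (auto simp: fun_eq_iff sets_history E_None E_Some split: bool.split)
  ultimately have ind: "indep_set (sets (history M S X N Y J)) (sigma_sets (space M) (E (Some l)))"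
    by (simp add: indep_set_def)
  have "indep_set (sigma_sets (space M) {G -` A \<inter> space M | A. A \<in> sets T}) (sigma_sets (space M) (E (Some l)))"
  proof -
    have "{G -` A \<inter> space M | A. A \<in> sets T} \<subseteq> sets (history M S X N Y J)"
      using measurable_sets[OF G] by auto
    from sets.sigma_sets_subset[OF this]
    have "sigma_sets (space M) {G -` A \<inter> space M | A. A \<in> sets T} \<subseteq> sets (history M S X N Y J)"
      by simp
    then show ?thesis
      using ind unfolding indep_sets2_eq by blast
  qed
  moreover have "G \<in> measurable M T"
    using history_measurable_imp_measurable[OF X _ G] Y J by auto
  ultimately show ?thesis
    using Y l unfolding indep_var_eq by (simp add: E_Some)
qed

text \<open>The summands are martingale differences, since the noise is centred and the coefficient of
  each noise variable depends on the strict past only. Hence they are orthogonal, and bounded coefficients keep their second moments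
  bounded, so the strong law for orthogonal variables applies.\<close>

lemma (in prob_space) predictable_noise_average_tendsto_0:
  fixes W :: "nat \<Rightarrow> nat \<Rightarrow> 'a \<Rightarrow> real" and c :: "nat \<Rightarrow> nat \<Rightarrow> 'a \<Rightarrow> real"
    and m :: nat and S :: "'b measure" and X :: "'a \<Rightarrow> 'b"
  defines "I \<equiv> {1..m} \<times> {1..}"
  defines "past \<equiv> \<lambda>n. history M S X (\<lambda>_. borel) (\<lambda>(k, n). W k n) ({1..m} \<times> {1..n})"
  assumes init: "indep_rvs M S X (Pi\<^sub>M I (\<lambda>_. borel)) (\<lambda>\<omega>. \<lambda>i\<in>I. W (fst i) (snd i) \<omega>)"
    and fam: "indep_vars (\<lambda>_. borel) (\<lambda>(k, n). W k n) I"
    and mean: "\<And>k n. k \<in> {1..m} \<Longrightarrow> n \<ge> 1 \<Longrightarrow> expectation (W k n) = 0"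
    and sq: "\<And>k n. k \<in> {1..m} \<Longrightarrow> n \<ge> 1 \<Longrightarrow> integrable M (\<lambda>\<omega>. (W k n \<omega>)\<^sup>2)"
    and var: "\<And>k n. k \<in> {1..m} \<Longrightarrow> n \<ge> 1 \<Longrightarrow> expectation (\<lambda>\<omega>. (W k n \<omega>)\<^sup>2) \<le> V"
    and c: "\<And>k n. k \<in> {1..m} \<Longrightarrow> c k n \<in> borel_measurable (past n)"
    and c_bound: "\<And>k n \<omega>. k \<in> {1..m} \<Longrightarrow> \<bar>c k n \<omega>\<bar> \<le> B"
  shows "AE \<omega> in M. (\<lambda>n. (\<Sum>i<n. \<Sum>k = 1..m. c k i \<omega> * W k (Suc i) \<omega>) / n) \<longlonglongrightarrow> 0"
proof -
  define Y where "Y i \<omega> = (\<Sum>k = 1..m. c k i \<omega> * W k (Suc i) \<omega>)" for i \<omega>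
  have Xm: "X \<in> measurable M S" using init by (simp add: indep_rvs_def)
  have [measurable]: "W k n \<in> borel_measurable M" if "k \<in> {1..m}" "n \<ge> 1" for k n
    using fam that by (auto simp: indep_vars_def I_def)
  have past_M: "g \<in> borel_measurable M" if "g \<in> borel_measurable (past n)" for g :: "'a \<Rightarrow> real" and n
    using that unfolding past_def by (rule history_measurable_imp_measurable[rotated 2]) (auto simp: Xm)
  have past_mono: "g \<in> borel_measurable (past n)" if "g \<in> borel_measurable (past i)" "i \<le> n"
    for g :: "'a \<Rightarrow> real" and i n
    using that measurable_history_mono[of "{1..m} \<times> {1..i}" "{1..m} \<times> {1..n}"]
    unfolding past_def by fastforce
  have W_past [measurable]: "W k i \<in> borel_measurable (past n)" if "k \<in> {1..m}" "i \<in> {1..n}" for k i n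
    using noise_measurable_history[of "(k, i)" "{1..m} \<times> {1..n}" "\<lambda>(k, n). W k n" M "\<lambda>_. borel"] that
    by (simp add: past_def)
  have [measurable]: "c k n \<in> borel_measurable M" if "k \<in> {1..m}" for k n
    by (rule past_M[OF c[OF that]])
  have Y_past: "Y i \<in> borel_measurable (past n)" if "i < n" for i n
  proof -
    have [measurable]: "c k i \<in> borel_measurable (past n)" if "k \<in> {1..m}" for k
      using past_mono[OF c[OF that]] \<open>i < n\<close> by simp
    have [measurable]: "W k (Suc i) \<in> borel_measurable (past n)" if "k \<in> {1..m}" for k
      using W_past that \<open>i < n\<close> by simp
    show ?thesis unfolding Y_def by measurable
  qed
  have B: "0 \<le> B" if "k \<in> {1..m}" for k
    using c_bound[OF that, of 0 undefined] by simp
  have term_le: "(c k i \<omega> * W k (Suc i) \<omega>)\<^sup>2 \<le> B\<^sup>2 * (W k (Suc i) \<omega>)\<^sup>2" if "k \<in> {1..m}" for k i \<omega>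
    unfolding power_mult_distrib
    using c_bound[OF that, of i \<omega>] by (intro mult_right_mono) (auto intro: abs_le_square_iff[THEN iffD1] simp: B[OF that])
  have Y_sq: "(Y i \<omega>)\<^sup>2 \<le> (\<Sum>k = 1..m. B\<^sup>2 * (W k (Suc i) \<omega>)\<^sup>2) * m" for i \<omega>
  proof -
    have "(Y i \<omega>)\<^sup>2 \<le> (\<Sum>k = 1..m. (c k i \<omega> * W k (Suc i) \<omega>)\<^sup>2) * card {1..m}"
      unfolding Y_def by (rule sum_squared_le_sum_of_squares)
    also have "\<dots> \<le> (\<Sum>k = 1..m. B\<^sup>2 * (W k (Suc i) \<omega>)\<^sup>2) * card {1..m}"
      by (intro mult_right_mono sum_mono term_le) auto
    finally show ?thesis by simp
  qed
  have dom_int: "integrable M (\<lambda>\<omega>. (\<Sum>k = 1..m. B\<^sup>2 * (W k (Suc i) \<omega>)\<^sup>2) * m)" for i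
    using sq by (intro integrable_mult_left Bochner_Integration.integrable_sum integrable_mult_right) auto
  have Y_meas [measurable]: "Y i \<in> borel_measurable M" for i
    unfolding Y_def by measurable
  have Y_int2: "integrable M (\<lambda>\<omega>. (Y i \<omega>)\<^sup>2)" for i
    by (rule Bochner_Integration.integrable_bound[OF dom_int[of i]])
      (auto intro!: AE_I2 order_trans[OF Y_sq] simp del: of_nat_mult)
  have Y_int: "integrable M (Y i)" for i
    by (rule square_integrable_imp_integrable[OF Y_meas Y_int2])
  have "AE \<omega> in M. (\<lambda>n. (\<Sum>i<n. Y i \<omega>) / n) \<longlonglongrightarrow> 0"
  proof (rule strong_law_orthogonal[OF Y_meas Y_int2])
    show "expectation (\<lambda>\<omega>. (Y i \<omega>)\<^sup>2) \<le> (\<Sum>k = 1..m. B\<^sup>2 * V) * m" for i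
    proof -
      have "expectation (\<lambda>\<omega>. (Y i \<omega>)\<^sup>2) \<le> expectation (\<lambda>\<omega>. (\<Sum>k = 1..m. B\<^sup>2 * (W k (Suc i) \<omega>)\<^sup>2) * m)"
        by (rule integral_mono[OF Y_int2 dom_int Y_sq])
      also have "\<dots> = (\<Sum>k = 1..m. B\<^sup>2 * expectation (\<lambda>\<omega>. (W k (Suc i) \<omega>)\<^sup>2)) * m"
        using sq by (simp add: Bochner_Integration.integral_sum)
      also have "\<dots> \<le> (\<Sum>k = 1..m. B\<^sup>2 * V) * m"
        using var by (intro mult_right_mono sum_mono mult_left_mono) auto
      finally show ?thesis .
    qed
    \<comment> \<open>For \<open>i < j\<close> the factor \<open>Y i * c k j\<close> belongs to the past of time \<open>j\<close>, so the centred variable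
      \<open>W k (Suc j)\<close> can be split off by independence.\<close>
    fix i j :: nat assume "i < j"
    have factor: "integrable M (\<lambda>\<omega>. (Y i \<omega> * c k j \<omega>) * W k (Suc j) \<omega>)
        \<and> expectation (\<lambda>\<omega>. (Y i \<omega> * c k j \<omega>) * W k (Suc j) \<omega>) = 0"
      if k: "k \<in> {1..m}" for k
    proof -
      have [measurable]: "c k j \<in> borel_measurable M" "W k (Suc j) \<in> borel_measurable M"
        using k by measurable
      have "(\<lambda>\<omega>. Y i \<omega> * c k j \<omega>) \<in> borel_measurable (past j)"
        by (rule borel_measurable_times[OF Y_past[OF \<open>i < j\<close>] c[OF k]])
      moreover have "indep_rvs M S X (Pi\<^sub>M I (\<lambda>_. borel)) (\<lambda>\<omega>. \<lambda>i\<in>I. (case i of (k, n) \<Rightarrow> W k n) \<omega>)"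
        using init by (simp add: case_prod_beta)
      moreover have "{1..m} \<times> {1..j} \<subseteq> I" by (auto simp: I_def)
      ultimately have ind: "indep_var borel (\<lambda>\<omega>. Y i \<omega> * c k j \<omega>) borel (W k (Suc j))"
        using indep_history_noise[OF _ fam, where J = "{1..m} \<times> {1..j}" and l = "(k, Suc j)"
            and S = S and X = X and G = "\<lambda>\<omega>. Y i \<omega> * c k j \<omega>" and T = borel] k
        by (auto simp: past_def I_def)
      have int1: "integrable M (\<lambda>\<omega>. Y i \<omega> * c k j \<omega>)"
      proof (rule Bochner_Integration.integrable_bound)
        show "integrable M (\<lambda>\<omega>. Y i \<omega> * B)" using Y_int by simp
        show "AE \<omega> in M. norm (Y i \<omega> * c k j \<omega>) \<le> norm (Y i \<omega> * B)"
          using c_bound[OF k] B[OF k] by (auto simp: abs_mult intro!: mult_left_mono)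
      qed measurable
      have int2: "integrable M (W k (Suc j))"
        by (rule square_integrable_imp_integrable[OF _ sq[OF k]]) simp_all
      show ?thesis
        using indep_var_integrable[OF ind int1 int2] indep_var_lebesgue_integral[OF ind int1 int2] mean[OF k]
        by simp
    qed
    have "expectation (\<lambda>\<omega>. Y i \<omega> * Y j \<omega>)
        = expectation (\<lambda>\<omega>. \<Sum>k = 1..m. (Y i \<omega> * c k j \<omega>) * W k (Suc j) \<omega>)"
      unfolding Y_def[of j] by (simp add: sum_distrib_left mult.assoc)
    also have "\<dots> = (\<Sum>k = 1..m. expectation (\<lambda>\<omega>. (Y i \<omega> * c k j \<omega>) * W k (Suc j) \<omega>))"
      by (rule Bochner_Integration.integral_sum) (use factor in blast)
    also have "\<dots> = 0"
      by (rule sum.neutral) (use factor in blast)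
    finally show "expectation (\<lambda>\<omega>. Y i \<omega> * Y j \<omega>) = 0" .
  qed
  then show ?thesis unfolding Y_def .
qed

section \<open>The almost sure growth rate\<close>

lemma limsup_log_growth_rate_le:
  fixes x s :: "nat \<Rightarrow> real"
  assumes le: "\<And>n. x n \<le> a + real n * (r * \<Delta>) + s n"
    and s: "(\<lambda>n. s n / n) \<longlonglongrightarrow> 0" and \<Delta>: "\<Delta> > 0"
  shows "limsup (\<lambda>n. ereal (1 / (real n * \<Delta>) * x n)) \<le> ereal r"
proof -
  let ?u = "\<lambda>n. a / \<Delta> * (1 / real n) + r + s n / n / \<Delta>"
  have "?u \<longlonglongrightarrow> a / \<Delta> * 0 + r + 0 / \<Delta>"
    by (intro tendsto_intros s lim_1_over_n) (use \<Delta> in auto)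
  then have "(\<lambda>n. ereal (?u n)) \<longlonglongrightarrow> ereal r"
    by simp
  then have "limsup (\<lambda>n. ereal (?u n)) = ereal r"
    by (intro lim_imp_Limsup) auto
  moreover have "limsup (\<lambda>n. ereal (1 / (real n * \<Delta>) * x n)) \<le> limsup (\<lambda>n. ereal (?u n))"
  proof (rule Limsup_mono, rule eventually_mono[OF eventually_gt_at_top[of 0]])
    fix n :: nat assume "n > 0"
    have "1 / (real n * \<Delta>) * x n \<le> 1 / (real n * \<Delta>) * (a + real n * (r * \<Delta>) + s n)"
      using le \<Delta> by (intro mult_left_mono) auto
    also have "\<dots> = ?u n"
      using \<open>n > 0\<close> \<Delta> by (simp add: field_simps)
    finally show "ereal (1 / (real n * \<Delta>) * x n) \<le> ereal (?u n)" by simp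
  qed
  ultimately show ?thesis by simp
qed

lemma (in prob_space) symmetric_imp_expectation_0:
  fixes X :: "'a \<Rightarrow> real"
  assumes [measurable]: "X \<in> borel_measurable M"
    and sym: "distr M borel (\<lambda>\<omega>. - X \<omega>) = distr M borel X"
  shows "expectation X = 0"
proof -
  have "expectation X = (\<integral>x. x \<partial>distr M borel X)"
    by (simp add: integral_distr)
  also have "\<dots> = (\<integral>x. x \<partial>distr M borel (\<lambda>\<omega>. - X \<omega>))"
    by (simp add: sym)
  also have "\<dots> = - expectation X"
    by (simp add: integral_distr)
  finally show ?thesis by simp
qed

theorem theorem3p1:
  fixes b :: "real ^ 'd \<Rightarrow> real ^ 'd"
    and \<sigma> :: "nat \<Rightarrow> real ^ 'd \<Rightarrow> real ^ 'd"
    and m :: nat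
    and K \<Delta> :: real
    and lam :: ereal
    and M :: "'a measure"
    and \<eta>\<^sub>0 :: "'a \<Rightarrow> real"
    and Z\<^sub>0 :: "'a \<Rightarrow> real ^ 'd"
    and W :: "nat \<Rightarrow> nat \<Rightarrow> 'a \<Rightarrow> real"
  assumes b_C1: "has_continuous_partials b"
    and \<sigma>_C1: "\<And>k. k \<in> {1..m} \<Longrightarrow> has_continuous_partials (\<sigma> k)"
    and b_0: "b 0 = 0"
    and K_nonneg: "K \<ge> 0"
    and \<sigma>_bound: "\<And>k x. k \<in> {1..m} \<Longrightarrow> norm (\<sigma> k x) \<le> K * norm x"
    and lambda_eq: "- lam = (SUP x \<in> {x. x \<noteq> 0}. ereal (
          (x \<bullet> b x + 1 / 2 * (\<Sum>k = 1..m. (norm (\<sigma> k x))\<^sup>2)) / (norm x)\<^sup>2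
          - (\<Sum>k = 1..m. (x \<bullet> \<sigma> k x)\<^sup>2) / (norm x) ^ 4))"
    and lambda_neg: "- lam < 0"
    and Delta_pos: "\<Delta> > 0"
    and prob: "prob_space M"
    and eta_meas: "\<eta>\<^sub>0 \<in> borel_measurable M"
    and Z_meas: "Z\<^sub>0 \<in> borel_measurable M"
    and eta_pos: "AE \<omega> in M. \<eta>\<^sub>0 \<omega> > 0"
    and Z_unit: "AE \<omega> in M. norm (Z\<^sub>0 \<omega>) = 1"
    and W_indep: "prob_space.indep_vars M (\<lambda>_. borel) (\<lambda>(k, n). W k n) ({1..m} \<times> {1..})"
    and W_ident: "\<And>k n k' n'. \<lbrakk>k \<in> {1..m}; n \<ge> 1; k' \<in> {1..m}; n' \<ge> 1\<rbrakk>
          \<Longrightarrow> distr M borel (W k n) = distr M borel (W k' n')"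
    and W_symmetric: "\<And>k n. \<lbrakk>k \<in> {1..m}; n \<ge> 1\<rbrakk>
          \<Longrightarrow> distr M borel (\<lambda>\<omega>. - W k n \<omega>) = distr M borel (W k n)"
    and W_variance: "\<And>k n. \<lbrakk>k \<in> {1..m}; n \<ge> 1\<rbrakk> \<Longrightarrow> prob_space.variance M (W k n) = 1"
    and W_init_indep: "indep_rvs M
          (borel \<Otimes>\<^sub>M borel) (\<lambda>\<omega>. (\<eta>\<^sub>0 \<omega>, Z\<^sub>0 \<omega>))
          (Pi\<^sub>M ({1..m} \<times> {1..}) (\<lambda>_. borel)) (\<lambda>\<omega>. \<lambda>i \<in> {1..m} \<times> {1..}. W (fst i) (snd i) \<omega>)"
  shows "AE \<omega> in M.
     limsup (\<lambda>n. ereal (1 / (real n * \<Delta>) *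
       ln (norm (dn_approx m b \<sigma> \<Delta> (\<lambda>k n. W k n \<omega>) (\<eta>\<^sub>0 \<omega>) (Z\<^sub>0 \<omega>) n)))) \<le> - lam"
proof -
  interpret prob_space M by (rule prob)
  define s where "s n \<omega> = dn_scheme m b \<sigma> \<Delta> (\<lambda>k n. W k n \<omega>) (\<eta>\<^sub>0 \<omega>) (Z\<^sub>0 \<omega>) n" for n \<omega>
  define g where "g x = (x \<bullet> b x + 1 / 2 * (\<Sum>k = 1..m. (norm (\<sigma> k x))\<^sup>2)) / (norm x)\<^sup>2
          - (\<Sum>k = 1..m. (x \<bullet> \<sigma> k x)\<^sup>2) / (norm x) ^ 4" for x
  have g_le: "ereal (g x) \<le> - lam" if "x \<noteq> 0" for x
    unfolding lambda_eq g_def by (rule SUP_upper) (use that in simp)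
  \<comment> \<open>The supremum is finite: it is negative, and it dominates the value at a unit vector.\<close>
  obtain r where r: "- lam = ereal r"
  proof (cases "- lam")
    case MInf
    then show ?thesis using g_le[of "axis undefined 1"] by (simp add: axis_eq_0_iff)
  qed (use lambda_neg in auto)
  have W_meas [measurable]: "W k n \<in> borel_measurable M" if "k \<in> {1..m}" "n \<ge> 1" for k n
    using W_indep that by (auto simp: indep_vars_def)
  have W_mean: "expectation (W k n) = 0" if "k \<in> {1..m}" "n \<ge> 1" for k n
    using that by (intro symmetric_imp_expectation_0 W_symmetric W_meas)
  have W_var: "expectation (\<lambda>\<omega>. (W k n \<omega>)\<^sup>2) = 1" if "k \<in> {1..m}" "n \<ge> 1" for k n
    using W_variance[OF that] W_mean[OF that] by simp
  \<comment> \<open>A function that is not integrable has integral \<open>0\<close>, so variance \<open>1\<close> forces square integrability.\<close>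
  have W_sq: "integrable M (\<lambda>\<omega>. (W k n \<omega>)\<^sup>2)" if "k \<in> {1..m}" "n \<ge> 1" for k n
    using W_var[OF that] not_integrable_integral_eq by fastforce

  define past where "past n = history M (borel \<Otimes>\<^sub>M borel) (\<lambda>\<omega>. (\<eta>\<^sub>0 \<omega>, Z\<^sub>0 \<omega>))
    (\<lambda>_. borel) (\<lambda>(k, n). W k n) ({1..m} \<times> {1..n})" for n
  have init: "(\<lambda>\<omega>. (\<eta>\<^sub>0 \<omega>, Z\<^sub>0 \<omega>)) \<in> measurable (past n) (borel \<Otimes>\<^sub>M borel)" for n
    unfolding past_def by (intro initial_measurable_history measurable_Pair eta_meas Z_meas)
  have init_past: "\<eta>\<^sub>0 \<in> borel_measurable (past n)" "Z\<^sub>0 \<in> borel_measurable (past n)" for n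
    using measurable_compose[OF init measurable_fst] measurable_compose[OF init measurable_snd] by simp_all
  have W_past: "W k i \<in> borel_measurable (past n)" if "k \<in> {1..m}" "i \<in> {1..n}" for k i n
    using noise_measurable_history[of "(k, i)" "{1..m} \<times> {1..n}" "\<lambda>(k, n). W k n" M "\<lambda>_. borel"] that
    by (simp add: past_def)
  have b_meas: "b \<in> borel_measurable borel"
    by (intro borel_measurable_continuous_onI has_continuous_partials_imp_continuous_on b_C1)
  have \<sigma>_meas: "\<sigma> k \<in> borel_measurable borel" if "k \<in> {1..m}" for k
    by (intro borel_measurable_continuous_onI has_continuous_partials_imp_continuous_on \<sigma>_C1 that)
  have s_past [measurable]: "(\<lambda>\<omega>. fst (s n \<omega>)) \<in> borel_measurable (past n)"
      "(\<lambda>\<omega>. snd (s n \<omega>)) \<in> borel_measurable (past n)" for n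
    unfolding s_def by (intro dn_scheme_measurable b_meas \<sigma>_meas init_past W_past; assumption)+

  define q where "q k n \<omega> = snd (s n \<omega>) \<bullet> rescale (\<sigma> k) (fst (s n \<omega>)) (snd (s n \<omega>))" for k n \<omega>
  \<comment> \<open>The bound \<open>\<bar>q\<bar> \<le> K\<close> holds only where \<open>\<eta>\<^sub>0\<close> is positive and \<open>Z\<^sub>0\<close> is a unit vector; truncation
    gives coefficients that are bounded everywhere and agree with \<open>q\<close> almost surely.\<close>
  define c where "c k n \<omega> = max (- K) (min K (q k n \<omega>)) * sqrt \<Delta>" for k n \<omega>
  have c_past: "c k n \<in> borel_measurable (past n)" if "k \<in> {1..m}" for k n
  proof -
    note \<sigma>_meas[OF that, measurable]
    show ?thesis unfolding c_def q_def by measurable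
  qed
  have c_bound: "\<bar>c k n \<omega>\<bar> \<le> K * sqrt \<Delta>" for k n \<omega>
    unfolding c_def abs_mult using K_nonneg Delta_pos by (intro mult_mono) auto
  have "AE \<omega> in M. (\<lambda>n. (\<Sum>i<n. \<Sum>k = 1..m. c k i \<omega> * W k (Suc i) \<omega>) / n) \<longlonglongrightarrow> 0"
    using W_var
    by (intro predictable_noise_average_tendsto_0[OF W_init_indep W_indep, where V = 1 and B = "K * sqrt \<Delta>"]
        W_mean W_sq c_bound c_past[unfolded past_def]) auto
  with eta_pos Z_unit show ?thesis
  proof eventually_elim
    case (elim \<omega>)
    have pos: "fst (s n \<omega>) > 0" and unit: "norm (snd (s n \<omega>)) = 1" for n
      using dn_scheme_pos_unit[OF elim(1,2)] by (auto simp: s_def)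
    have q_bound: "\<bar>q k n \<omega>\<bar> \<le> K" if "k \<in> {1..m}" for k n
    proof -
      have "\<bar>q k n \<omega>\<bar> \<le> norm (snd (s n \<omega>)) * norm (rescale (\<sigma> k) (fst (s n \<omega>)) (snd (s n \<omega>)))"
        unfolding q_def by (rule Cauchy_Schwarz_ineq2)
      also have "\<dots> \<le> K"
        using norm_rescale_le[OF \<sigma>_bound[OF that] pos unit] by (simp add: unit)
      finally show ?thesis .
    qed
    have c_eq: "c k n \<omega> = q k n \<omega> * sqrt \<Delta>" if "k \<in> {1..m}" for k n
      using q_bound[OF that, of n] by (simp add: c_def)
    have drift: "norm_drift m b \<sigma> (fst (s n \<omega>)) (snd (s n \<omega>)) \<le> r" for n
    proof -
      have "fst (s n \<omega>) *\<^sub>R snd (s n \<omega>) \<noteq> 0"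
        using pos[of n] unit[of n] by auto
      from g_le[OF this] show ?thesis
        unfolding norm_drift_eq[OF pos unit] g_def r by simp
    qed
    have norm_X: "norm (dn_approx m b \<sigma> \<Delta> (\<lambda>k n. W k n \<omega>) (\<eta>\<^sub>0 \<omega>) (Z\<^sub>0 \<omega>) n) = fst (s n \<omega>)" for n
      using pos[of n] unit[of n] by (simp add: dn_approx_def s_def)
    have ln_le: "ln (fst (s n \<omega>)) \<le> ln (\<eta>\<^sub>0 \<omega>) + real n * (r * \<Delta>)
        + (\<Sum>i<n. \<Sum>k = 1..m. c k i \<omega> * W k (Suc i) \<omega>)" for n
    proof -
      have "ln (fst (s n \<omega>)) = ln (\<eta>\<^sub>0 \<omega>) + (\<Sum>i<n. norm_drift m b \<sigma> (fst (s i \<omega>)) (snd (s i \<omega>))) * \<Delta>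
          + (\<Sum>i<n. \<Sum>k = 1..m. c k i \<omega> * W k (Suc i) \<omega>)"
        using ln_dn_scheme[OF elim(1,2), of m b \<sigma> \<Delta> "\<lambda>k n. W k n \<omega>" n] by (simp add: c_eq q_def s_def)
      moreover have "(\<Sum>i<n. norm_drift m b \<sigma> (fst (s i \<omega>)) (snd (s i \<omega>))) * \<Delta> \<le> (\<Sum>i<n. r) * \<Delta>"
        using Delta_pos by (intro mult_right_mono sum_mono drift) auto
      ultimately show ?thesis by (simp add: mult.assoc)
    qed
    show ?case
      unfolding norm_X r by (rule limsup_log_growth_rate_le[OF ln_le elim(3) Delta_pos])
  qed
qed

end
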